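(* In the planar four-body problem there are no central configurations with positive masses at the vertices of a parallelogram, excluding squares and rhombi. That is, if four positive masses at the vertices of a parallelogram form a central configuration, then the parallelogram is a rhombus (possibly a square).
   Context: A configuration $(q_1,\dots,q_4)$ of pairwise distinct points of $\mathbb{R}^2$ with positive masses $m_1,\dots,m_4$ is a central configuration if there is $\lambda>0$ with $\sum_{j\ne k} m_j\,(q_j-q_k)/\|q_j-q_k\|^3=-\lambda\,(q_k-\mathbf{c})$ for all $k$, where $\mathbf{c}=\sum m_kq_k/\sum m_k$. A parallelogram is a non-degenerate convex quadrilateral with two pairs of parallel sides; a rhombus is a parallelogram with four sides of equal length. *)

theory Defs
  imports "HOL-Analysis.Analysis"
begin

definition center_of_mass :: "('i::finite \<Rightarrow> real) \<Rightarrow> ('i \<Rightarrow> real^2) \<Rightarrow> real^2" where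
  "center_of_mass m q = (1 / (\<Sum>k\<in>UNIV. m k)) *\<^sub>R (\<Sum>k\<in>UNIV. m k *\<^sub>R q k)"

definition central_configuration :: "('i::finite \<Rightarrow> real) \<Rightarrow> ('i \<Rightarrow> real^2) \<Rightarrow> bool" where
  "central_configuration m q \<longleftrightarrow>
     inj q \<and>
     (\<exists>l>0. \<forall>k.
        (\<Sum>j\<in>UNIV - {k}. (m j / norm (q j - q k) ^ 3) *\<^sub>R (q j - q k))
          = - l *\<^sub>R (q k - center_of_mass m q))"

text \<open>Vertices are listed in cyclic order, so the sides are \<open>AB\<close>, \<open>BC\<close>, \<open>CD\<close>, \<open>DA\<close>.
  Non-degenerate: no three vertices are collinear (in particular they are pairwise distinct).
  Convex: the four sides are edges of the convex hull of the vertices, which rules out both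
  reflex vertices and self-crossing vertex orders.\<close>

definition convex_quadrilateral :: "real^2 \<Rightarrow> real^2 \<Rightarrow> real^2 \<Rightarrow> real^2 \<Rightarrow> bool" where
  "convex_quadrilateral A B C D \<longleftrightarrow>
     \<not> collinear {A, B, C} \<and> \<not> collinear {B, C, D} \<and>
     \<not> collinear {C, D, A} \<and> \<not> collinear {D, A, B} \<and>
     closed_segment A B edge_of convex hull {A, B, C, D} \<and>
     closed_segment B C edge_of convex hull {A, B, C, D} \<and>
     closed_segment C D edge_of convex hull {A, B, C, D} \<and>
     closed_segment D A edge_of convex hull {A, B, C, D}"

definition parallelogram :: "real^2 \<Rightarrow> real^2 \<Rightarrow> real^2 \<Rightarrow> real^2 \<Rightarrow> bool" where
  "parallelogram A B C D \<longleftrightarrow>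
     convex_quadrilateral A B C D \<and>
     affine_parallel (affine hull {A, B}) (affine hull {C, D}) \<and>
     affine_parallel (affine hull {B, C}) (affine hull {D, A})"

definition rhombus :: "real^2 \<Rightarrow> real^2 \<Rightarrow> real^2 \<Rightarrow> real^2 \<Rightarrow> bool" where
  "rhombus A B C D \<longleftrightarrow>
     parallelogram A B C D \<and>
     dist A B = dist B C \<and> dist B C = dist C D \<and> dist C D = dist D A"

end

theory Submission imports Defs begin

text \<open>
  Write \<open>u = B - A\<close> and \<open>v = C - B = D - A\<close>, and let \<open>M\<close> be the total mass. Moving the
  right-hand side of the equation of a central configuration into the sum turns it into
  \<open>\<Sum>j. m j * (1 / r j k ^ 3 - l / M) * (q j - q k) = 0\<close>. Put \<open>S = 1 / \<parallel>u\<parallel> ^ 3 - l / M\<close> and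
  \<open>T = 1 / \<parallel>v\<parallel> ^ 3 - l / M\<close>. Comparing the coefficients of the independent vectors \<open>u\<close> and \<open>v\<close> at
  \<open>A\<close> gives \<open>m B * S = m D * T\<close>, as the diagonal \<open>AC\<close> contributes equally to both; at \<open>C\<close> it
  gives \<open>m D * S = m B * T\<close>. Adding up, \<open>S = T\<close>, so adjacent sides have equal length.
\<close>

lemma central_configuration_pairwise:
  fixes m :: "'i::finite \<Rightarrow> real" and q :: "'i \<Rightarrow> real^2"
  assumes "central_configuration m q" and M: "sum m UNIV \<noteq> 0"
  obtains \<mu> where
    "\<And>k. (\<Sum>j\<in>UNIV - {k}. (m j * (1 / norm (q j - q k) ^ 3 - \<mu>)) *\<^sub>R (q j - q k)) = 0"
proof -
  obtain l where l: "\<And>k. (\<Sum>j\<in>UNIV - {k}. (m j / norm (q j - q k) ^ 3) *\<^sub>R (q j - q k))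
      = - l *\<^sub>R (q k - center_of_mass m q)"
    using assms(1) unfolding central_configuration_def by blast
  have "(\<Sum>j\<in>UNIV - {k}. (m j * (1 / norm (q j - q k) ^ 3 - l / sum m UNIV)) *\<^sub>R (q j - q k)) = 0"
    for k
  proof -
    \<comment> \<open>The omitted term \<open>j = k\<close> is zero, so the sum may run over all
      bodies; it is then the total mass times the vector from \<open>q k\<close> to the center of
      mass.\<close>
    have "(\<Sum>j\<in>UNIV - {k}. m j *\<^sub>R (q j - q k)) = (\<Sum>j\<in>UNIV. m j *\<^sub>R (q j - q k))"
      by (simp add: sum.remove[of UNIV k])
    also have "\<dots> = (\<Sum>j\<in>UNIV. m j *\<^sub>R q j) - sum m UNIV *\<^sub>R q k"
      by (simp add: scaleR_diff_right sum_subtractf scaleR_sum_left)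
    finally have "(l / sum m UNIV) *\<^sub>R (\<Sum>j\<in>UNIV - {k}. m j *\<^sub>R (q j - q k))
        = - l *\<^sub>R (q k - center_of_mass m q)"
      using M by (simp add: center_of_mass_def scaleR_diff_right)
    then show ?thesis
      using l[of k]
      by (simp add: right_diff_distrib scaleR_diff_left sum_subtractf scaleR_sum_right mult.commute)
  qed
  then show ?thesis by (rule that)
qed

lemma not_collinear_sides_independent:
  fixes A B C :: "'a::real_inner"
  assumes "\<not> collinear {A, B, C}" and eq: "x *\<^sub>R (B - A) + y *\<^sub>R (C - B) = 0"
  shows "x = 0 \<and> y = 0"
proof -
  have nc: "\<not> collinear {0, A - B, C - B}"
    using assms(1) collinear_3[of A B C] by simp
  have e: "y *\<^sub>R (C - B) = x *\<^sub>R (A - B)"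
    using eq by (simp add: algebra_simps)
  have "y = 0"
  proof (rule ccontr)
    assume "y \<noteq> 0"
    then have "C - B = (x / y) *\<^sub>R (A - B)"
      using arg_cong[OF e, of "\<lambda>w. (1 / y) *\<^sub>R w"] by simp
    with nc show False by (auto simp: collinear_lemma)
  qed
  with e nc show ?thesis by (auto simp: collinear_lemma)
qed

text \<open>The translation carrying one hull onto the other cancels in \<open>D - C\<close>,
  leaving a difference of two affine combinations of \<open>A\<close> and \<open>B\<close>.\<close>

lemma affine_parallel_lines_direction:
  fixes A B C D :: "'a::real_vector"
  assumes "affine_parallel (affine hull {A, B}) (affine hull {C, D})"
  obtains s where "D - C = s *\<^sub>R (B - A)"
proof -
  obtain w where w: "affine hull {C, D} = (\<lambda>x. w + x) ` (affine hull {A, B})"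
    using assms unfolding affine_parallel_def by blast
  have "C \<in> (\<lambda>x. w + x) ` (affine hull {A, B})" "D \<in> (\<lambda>x. w + x) ` (affine hull {A, B})"
    unfolding w[symmetric] by (auto intro: hull_inc)
  then obtain a b c d where
    C: "C = w + (a *\<^sub>R A + b *\<^sub>R B)" "a + b = 1" and D: "D = w + (c *\<^sub>R A + d *\<^sub>R B)" "c + d = 1"
    unfolding affine_hull_2 by auto
  have ac: "a = 1 - b" "c = 1 - d"
    using C(2) D(2) by simp_all
  have "D - C = (d - b) *\<^sub>R (B - A)"
    unfolding C(1) D(1) ac by (simp add: algebra_simps)
  then show ?thesis by (rule that)
qed

text \<open>The side vectors add up to zero. Parallelism expresses them through the independent
  sides \<open>B - A\<close> and \<open>C - B\<close>, so both coefficients vanish and the factor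
  \<open>s\<close> is -1.\<close>

lemma parallelogram_opposite_sides:
  assumes "parallelogram A B C D"
  shows "D - C = A - B"
proof -
  have nc: "\<not> collinear {A, B, C}"
    using assms by (simp add: parallelogram_def convex_quadrilateral_def)
  obtain s t where s: "D - C = s *\<^sub>R (B - A)" and t: "A - D = t *\<^sub>R (C - B)"
    using assms affine_parallel_lines_direction unfolding parallelogram_def by metis
  have "(B - A) + (C - B) + (D - C) + (A - D) = 0"
    by simp
  then have "(1 + s) *\<^sub>R (B - A) + (1 + t) *\<^sub>R (C - B) = 0"
    unfolding s t by (simp add: algebra_simps)
  then have "s = -1"
    using not_collinear_sides_independent[OF nc] by fastforce
  with s show ?thesis by simp
qed

theorem proposition4:
  fixes m :: "4 \<Rightarrow> real" and q :: "4 \<Rightarrow> real^2" and A B C D :: "real^2"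
  assumes "\<And>k. m k > 0"
    and "central_configuration m q"
    and "parallelogram A B C D"
    and "range q = {A, B, C, D}"
  shows "rhombus A B C D"
proof -
  have nc: "\<not> collinear {A, B, C}"
    and "\<not> collinear {B, C, D}" "\<not> collinear {C, D, A}" "\<not> collinear {D, A, B}"
    using assms(3) by (simp_all add: parallelogram_def convex_quadrilateral_def)
  then have distinct: "A \<noteq> B" "A \<noteq> C" "A \<noteq> D" "B \<noteq> C" "B \<noteq> D" "C \<noteq> D"
    by (auto simp: insert_commute)
  have inj: "inj q"
    using assms(2) by (simp add: central_configuration_def)
  have "A \<in> range q" "B \<in> range q" "C \<in> range q" "D \<in> range q"
    using assms(4) by auto
  \<comment> \<open>The range does not tell which body sits at which vertex; these indices name the
    bodies by vertex.\<close>
  then obtain a b c d where q: "q a = A" "q b = B" "q c = C" "q d = D"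
    by (metis imageE)
  have univ: "UNIV = {a, b, c, d}"
  proof -
    have "q ` UNIV = q ` {a, b, c, d}"
      using assms(4) q by simp
    then show ?thesis
      unfolding inj_image_eq_iff[OF inj] .
  qed
  have idx: "a \<noteq> b" "a \<noteq> c" "a \<noteq> d" "b \<noteq> c" "b \<noteq> d" "c \<noteq> d"
    using distinct q by auto
  have "sum m UNIV > 0"
    by (rule sum_pos) (auto simp: assms(1))
  then obtain \<mu> where \<mu>:
    "\<And>k. (\<Sum>j\<in>UNIV - {k}. (m j * (1 / norm (q j - q k) ^ 3 - \<mu>)) *\<^sub>R (q j - q k)) = 0"
    using central_configuration_pairwise[OF assms(2)] by auto
  define u v where "u = B - A" and "v = C - B"
  \<comment> \<open>\<open>R\<close> belongs to the diagonal \<open>AC\<close>, the only one that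
    ends at \<open>A\<close> or \<open>C\<close>; the length of \<open>BD\<close> does not enter the
    equations there.\<close>
  define S T R where "S = 1 / norm u ^ 3 - \<mu>" and "T = 1 / norm v ^ 3 - \<mu>"
    and "R = 1 / norm (u + v) ^ 3 - \<mu>"
  have DC: "D - C = - u"
    using parallelogram_opposite_sides[OF assms(3)] by (simp add: u_def)
  have DA: "D - A = v"
    using DC by (simp add: u_def v_def algebra_simps)
  have CA: "C - A = u + v" and AC: "A - C = - (u + v)" and BC: "B - C = - v"
    by (simp_all add: u_def v_def)
  have "UNIV - {a} = {b, c, d}" "UNIV - {c} = {a, b, d}"
    unfolding univ using idx by auto
  then have "(m b * S) *\<^sub>R u + ((m c * R) *\<^sub>R (u + v) + (m d * T) *\<^sub>R v) = 0"
    and "(m a * R) *\<^sub>R - (u + v) + ((m b * T) *\<^sub>R - v + (m d * S) *\<^sub>R - u) = 0"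
    using \<mu>[of a] \<mu>[of c] idx q
    unfolding S_def T_def R_def
    by (simp_all only: sum.insert finite_insert finite.emptyI insert_iff empty_iff simp_thms
        sum.empty add_0_right CA AC BC DC DA norm_minus_cancel u_def[symmetric])
  \<comment> \<open>Terms are collected by \<open>u\<close> and \<open>v\<close>; the equation at
    \<open>C\<close> also changes sign.\<close>
  then have "(m b * S + m c * R) *\<^sub>R u + (m c * R + m d * T) *\<^sub>R v = 0"
    and "(m a * R + m d * S) *\<^sub>R u + (m a * R + m b * T) *\<^sub>R v = 0"
    by (simp_all add: algebra_simps neg_eq_iff_add_eq_0)
  then have "m b * S + m c * R = 0" "m c * R + m d * T = 0"
      "m a * R + m d * S = 0" "m a * R + m b * T = 0"
    using not_collinear_sides_independent[OF nc] unfolding u_def v_def by blast+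
  then have "(m b + m d) * (S - T) = 0"
    by (simp add: algebra_simps)
  then have "S = T"
    using assms(1)[of b] assms(1)[of d] by (simp add: add_pos_pos less_imp_neq[symmetric])
  then have "norm u ^ 3 = norm v ^ 3"
    by (simp add: S_def T_def)
  then have "norm u = norm v"
    by (simp add: power_eq_iff_eq_base)
  then show ?thesis
    using assms(3) DC DA unfolding rhombus_def
    by (metis dist_norm norm_minus_cancel norm_minus_commute u_def v_def)
qed

end
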